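(* (Grünbaum conjecture) $\lambda_2 = 4/3$. That is: for every real normed space $X$ and every $2$-dimensional linear subspace $E \subset X$, there is a linear projection $P$ from $X$ onto $E$ with operator norm $\|P\| \le 4/3$, and $4/3$ is the smallest constant with this property.
   Context: For an integer $n \ge 1$, $\lambda_n$ denotes the smallest constant such that onto each $n$-dimensional subspace $E$ of any real normed space $X$ there is a projection of norm at most $\lambda_n$. A projection from $X$ onto $E$ is a bounded linear map $P : X \to X$ with image $E$ and $P e = e$ for all $e \in E$; $\|P\| = \sup\{\|Px\| : \|x\| \le 1\}$ is its operator norm. *)

theory Defs
  imports "HOL-Analysis.Analysis"
begin

(* HOL cannot quantify over types inside a formula, so "for every real normed space X" is
   expressed by a carrier V, a linear subspace of an ambient vector space 'v, together with
   a norm N whose values outside V are irrelevant.  Every real normed space arises in this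
   way for a suitable 'v. *)
definition normed_space_on :: "'v::real_vector set \<Rightarrow> ('v \<Rightarrow> real) \<Rightarrow> bool" where
  "normed_space_on V N \<longleftrightarrow>
     subspace V \<and>
     (\<forall>x\<in>V. 0 \<le> N x) \<and>
     (\<forall>x\<in>V. N x = 0 \<longleftrightarrow> x = 0) \<and>
     (\<forall>a. \<forall>x\<in>V. N (a *\<^sub>R x) = \<bar>a\<bar> * N x) \<and>
     (\<forall>x\<in>V. \<forall>y\<in>V. N (x + y) \<le> N x + N y)"

definition bounded_linear_on :: "'v::real_vector set \<Rightarrow> ('v \<Rightarrow> real) \<Rightarrow> ('v \<Rightarrow> 'v) \<Rightarrow> bool" where
  "bounded_linear_on V N P \<longleftrightarrow>
     P ` V \<subseteq> V \<and>
     (\<forall>x\<in>V. \<forall>y\<in>V. P (x + y) = P x + P y) \<and>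
     (\<forall>a. \<forall>x\<in>V. P (a *\<^sub>R x) = a *\<^sub>R P x) \<and>
     (\<exists>K. \<forall>x\<in>V. N (P x) \<le> K * N x)"

(* The set is nonempty, and bounded above whenever P is bounded, so the supremum is proper. *)
definition op_norm_on :: "'v::real_vector set \<Rightarrow> ('v \<Rightarrow> real) \<Rightarrow> ('v \<Rightarrow> 'v) \<Rightarrow> real" where
  "op_norm_on V N P = (SUP x\<in>{x\<in>V. N x \<le> 1}. N (P x))"

definition projection_on ::
    "'v::real_vector set \<Rightarrow> ('v \<Rightarrow> real) \<Rightarrow> 'v set \<Rightarrow> ('v \<Rightarrow> 'v) \<Rightarrow> bool" where
  "projection_on V N E P \<longleftrightarrow>
     bounded_linear_on V N P \<and> P ` V = E \<and> (\<forall>e\<in>E. P e = e)"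

definition projection_bound :: "'v::real_vector itself \<Rightarrow> nat \<Rightarrow> real \<Rightarrow> bool" where
  "projection_bound TYPE('v) n c \<longleftrightarrow>
     (\<forall>(V::'v set) N E.
        normed_space_on V N \<and> subspace E \<and> E \<subseteq> V \<and> dim E = n \<longrightarrow>
        (\<exists>P. projection_on V N E P \<and> op_norm_on V N P \<le> c))"

(* The constant lambda_n (n \<ge> 1).  The ambient space 'v must be infinite-dimensional for this
   to be the intended constant: in a small ambient space (such as one of dimension n) there are
   too few normed spaces X, and the least bound is smaller. *)
definition projection_const :: "'v::real_vector itself \<Rightarrow> nat \<Rightarrow> real" where
  "projection_const TYPE('v) n = (LEAST c. projection_bound TYPE('v) n c)"

end

theory Submission
  imports Defs
begin

text \<open>
  A map \<open>P\<close> from \<open>X\<close> into the plane \<open>E\<close> is a linear functional on the tensor product of \<open>X\<close> with the dual of \<open>E\<close>.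
  By Hahn-Banach, a projection of norm at most 4/3 exists as soon as the trace of an
  operator \<open>\<Sum> g\<^sub>k \<otimes> x\<^sub>k\<close> on \<open>E\<close>, with functionals \<open>g\<^sub>k\<close> of norm at most 1 and \<open>x\<^sub>k\<close> in \<open>X\<close>, is at most
  4/3 times the sum of the weights \<open>d\<^sub>k = \<parallel>x\<^sub>k\<parallel>\<close>. Computing the trace in an orthonormal basis for the
  inner product \<open>\<Sum> d\<^sub>k g\<^sub>k \<otimes> g\<^sub>k\<close> turns the \<open>g\<^sub>k\<close> into plane vectors \<open>v\<^sub>k\<close> with \<open>\<Sum> d\<^sub>k v\<^sub>k v\<^sub>k\<^sup>T = I\<close> and
  bounds it by \<open>\<Sum> d\<^sub>j d\<^sub>k \<bar>v\<^sub>j \<bullet> v\<^sub>k\<bar>\<close>. In polar coordinates, \<open>\<bar>cos t\<bar> \<le> 2/3 + 7/18 cos 2t - 1/18 cos 4t\<close> reduces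
  this sum to three moments: the second moment enters with a negative sign, and the first one is
  controlled by the frame condition, which says that the doubled vectors have weighted mean zero.
\<close>

section \<open>Hahn-Banach extension dominated by a convex cone\<close>

text \<open>The cone \<open>K\<close> plays the role of the epigraph of the sublinear majorant, which therefore
  need not be computed as an infimum. Zorn's lemma is applied to graphs of partial functionals,
  which are subspaces of the product with the reals.\<close>

lemma cone_hahn_banach:
  fixes K :: "('a::real_vector \<times> real) set"
  assumes V: "subspace V" and G0: "subspace G0"
    and K0: "(0, 0) \<in> K"
    and Kadd: "\<And>x c y d. (x, c) \<in> K \<Longrightarrow> (y, d) \<in> K \<Longrightarrow> (x + y, c + d) \<in> K"
    and Kscale: "\<And>t x c. t > 0 \<Longrightarrow> (x, c) \<in> K \<Longrightarrow> (t *\<^sub>R x, t * c) \<in> K"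
    and total: "\<And>x. x \<in> V \<Longrightarrow> \<exists>c. (x, c) \<in> K"
    and dom: "\<And>x y c. (x, y) \<in> G0 \<Longrightarrow> (x, c) \<in> K \<Longrightarrow> y \<le> c"
  obtains f where "\<And>x y. x \<in> V \<Longrightarrow> y \<in> V \<Longrightarrow> f (x + y) = f x + f y"
    and "\<And>t x. x \<in> V \<Longrightarrow> f (t *\<^sub>R x) = t * f x"
    and "\<And>x y. x \<in> V \<Longrightarrow> (x, y) \<in> G0 \<Longrightarrow> f x = (y::real)"
    and "\<And>x c. x \<in> V \<Longrightarrow> (x, c) \<in> K \<Longrightarrow> f x \<le> c"
proof -
  define A where "A = {G. subspace G \<and> G0 \<subseteq> G \<and> (\<forall>x y c. (x, y) \<in> G \<longrightarrow> (x, c) \<in> K \<longrightarrow> y \<le> c)}"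
  have "\<exists>M\<in>A. \<forall>X\<in>A. M \<subseteq> X \<longrightarrow> X = M"
  proof (rule subset_Zorn_nonempty)
    show "A \<noteq> {}"
      using G0 dom by (auto simp: A_def)
    fix C assume ne: "C \<noteq> {}" and "subset.chain A C"
    then have CA: "\<And>G. G \<in> C \<Longrightarrow> G \<in> A" and ch: "\<And>G H. G \<in> C \<Longrightarrow> H \<in> C \<Longrightarrow> G \<subseteq> H \<or> H \<subseteq> G"
      by (auto simp: subset.chain_def)
    have "subspace (\<Union>C)"
    proof (rule subspaceI)
      show "0 \<in> \<Union>C"
        using ne CA by (auto simp: A_def subspace_0)
    next
      fix x y assume "x \<in> \<Union>C" "y \<in> \<Union>C"
      then obtain G H where GH: "G \<in> C" "H \<in> C" "x \<in> G" "y \<in> H" by blast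
      from ch[OF GH(1,2)] consider "x \<in> H" | "y \<in> G"
        using GH by blast
      then show "x + y \<in> \<Union>C"
      proof cases
        case 1 then show ?thesis using CA[OF GH(2)] GH by (auto simp: A_def intro: subspace_add)
      next
        case 2 then show ?thesis using CA[OF GH(1)] GH by (auto simp: A_def intro: subspace_add)
      qed
    next
      fix t x assume "x \<in> \<Union>C"
      then show "t *\<^sub>R x \<in> \<Union>C"
        using CA by (auto simp: A_def intro: subspace_scale)
    qed
    then show "\<Union>C \<in> A"
      using ne CA by (fastforce simp: A_def)
  qed
  then obtain G where GA: "G \<in> A" and Gmax: "\<And>X. X \<in> A \<Longrightarrow> G \<subseteq> X \<Longrightarrow> X = G"
    by blast
  have G: "subspace G" and G0G: "G0 \<subseteq> G"
    and Gdom: "\<And>x y c. (x, y) \<in> G \<Longrightarrow> (x, c) \<in> K \<Longrightarrow> y \<le> c"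
    using GA by (auto simp: A_def)
  have Gadd: "(x + x', y + y') \<in> G" if "(x, y) \<in> G" "(x', y') \<in> G" for x x' y y'
    using subspace_add[OF G that] by simp
  have Gscale: "(t *\<^sub>R x, t * y) \<in> G" if "(x, y) \<in> G" for t x y
    using subspace_scale[OF G that, of t] by simp
  have G00: "(0, 0) \<in> G"
    using subspace_0[OF G] by (simp add: zero_prod_def)
  \<comment> \<open>Members of \<open>A\<close> are only subspaces; that \<open>G\<close> is
    single-valued comes from domination at \<open>(0, 0) \<in> K\<close>, applied to the difference
    of two values with both signs.\<close>
  have zero: "y \<le> 0" if "(0, y) \<in> G" for y
    using Gdom[OF that K0] .
  have uniq: "y = y'" if "(x, y) \<in> G" "(x, y') \<in> G" for x y y'
    using zero[of "y + (-1) * y'"] zero[of "y' + (-1) * y"]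
      Gadd[OF that(1) Gscale[OF that(2), of "-1"]] Gadd[OF that(2) Gscale[OF that(1), of "-1"]]
    by simp
  have tot: "\<exists>y. (x0, y) \<in> G" if x0: "x0 \<in> V" for x0
  proof -
    \<comment> \<open>A value \<open>a\<close> at \<open>x0\<close> must satisfy
      \<open>y - a \<le> c\<close> whenever \<open>(x - x0, c) \<in> K\<close>, so \<open>L\<close>
      collects its lower bounds. \<open>LU\<close> places each of them below every upper bound
      \<open>c' - y'\<close>, and \<open>Sup L\<close> is admissible.\<close>
    define L where "L = {y - c | x y c. (x, y) \<in> G \<and> (x - x0, c) \<in> K}"
    have LU: "y - c \<le> c' - y'" if "(x, y) \<in> G" "(x - x0, c) \<in> K" "(x', y') \<in> G" "(x' + x0, c') \<in> K"
      for x y c x' y' c'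
      using Gdom[OF Gadd[OF that(1,3)], of "c + c'"] Kadd[OF that(2,4)] by (simp add: add_ac)
    obtain c1 where c1: "(0 + x0, c1) \<in> K" using total[OF x0] by auto
    obtain c2 where c2: "(0 - x0, c2) \<in> K" using total[of "-x0"] x0 V by (auto simp: subspace_neg)
    have Lne: "L \<noteq> {}" using G00 c2 by (force simp: L_def)
    have Lbd: "bdd_above L"
      using LU[OF _ _ G00 c1] by (intro bdd_aboveI[of _ "c1 - 0"]) (auto simp: L_def)
    define a where "a = Sup L"
    have a1: "y - a \<le> c" if "(x, y) \<in> G" "(x - x0, c) \<in> K" for x y c
    proof -
      have "y - c \<in> L" using that by (auto simp: L_def)
      then show ?thesis using cSup_upper[OF _ Lbd] by (fastforce simp: a_def)
    qed
    have a2: "y + a \<le> c" if "(x, y) \<in> G" "(x + x0, c) \<in> K" for x y c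
    proof -
      have "a \<le> c - y"
        unfolding a_def by (rule cSup_least[OF Lne]) (use LU[OF _ _ that] in \<open>auto simp: L_def\<close>)
      then show ?thesis by simp
    qed
    define H where "H = {g + h | g h. g \<in> G \<and> h \<in> span {(x0, a)}}"
    have "subspace H"
      unfolding H_def by (rule subspace_sums[OF G subspace_span])
    moreover have GH: "G \<subseteq> H"
    proof
      fix g assume "g \<in> G"
      then have "g + 0 \<in> H" unfolding H_def using span_zero by blast
      then show "g \<in> H" by simp
    qed
    moreover have "y \<le> c" if xyH: "(x, y) \<in> H" and xcK: "(x, c) \<in> K" for x y c
    proof -
      obtain x1 y1 t where g: "(x1, y1) \<in> G" and xy: "x = x1 + t *\<^sub>R x0" "y = y1 + t * a"
        using xyH by (auto simp: H_def span_singleton)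
      \<comment> \<open>Dividing by the absolute value of \<open>t\<close> and using that
        \<open>K\<close> is a cone leaves the coefficients 1 and -1 of \<open>x0\<close>, which are
        \<open>a2\<close> and \<open>a1\<close>.\<close>
      consider "t = 0" | "t > 0" | "t < 0" by linarith
      then show ?thesis
      proof cases
        case 1 then show ?thesis using g xy Gdom xcK by simp
      next
        case 2
        have "(x1 /\<^sub>R t + x0, c / t) \<in> K"
          using Kscale[of "1/t", OF _ xcK] 2 xy by (simp add: algebra_simps divide_inverse)
        from mult_left_mono[OF a2[OF Gscale[OF g, of "inverse t"] this], of t] 2 show ?thesis
          by (simp add: xy distrib_left mult.assoc[symmetric])
      next
        case 3
        define r where "r = - t"
        have r: "t = - r" "r > 0" using 3 by (auto simp: r_def)
        have "(1/r) *\<^sub>R x = x1 /\<^sub>R r - x0"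
          using r(2) by (simp add: xy r(1) scaleR_diff_right divide_inverse)
        then have "(x1 /\<^sub>R r - x0, c / r) \<in> K"
          using Kscale[of "1/r", OF _ xcK] r(2) by simp
        from mult_left_mono[OF a1[OF Gscale[OF g, of "inverse r"] this], of r] r(2) show ?thesis
          by (simp add: xy r(1) right_diff_distrib mult.assoc[symmetric])
      qed
    qed
    \<comment> \<open>Maximality gives \<open>H = G\<close> whether or not \<open>x0\<close> was
      already in the domain, so \<open>(x0, a)\<close> lies in \<open>G\<close>.\<close>
    ultimately have "H \<in> A" using G0G by (auto simp: A_def)
    with Gmax GH have "H = G" by blast
    moreover have "(0, 0) + (x0, a) \<in> H"
      unfolding H_def using G00 span_base[of "(x0, a)" "{(x0, a)}"] by blast
    ultimately show ?thesis by auto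
  qed
  define f where "f x = (THE y. (x, y) \<in> G)" for x
  have f: "f x = y" if "(x, y) \<in> G" for x y
    unfolding f_def using that uniq by blast
  have fG: "(x, f x) \<in> G" if "x \<in> V" for x
    using tot[OF that] f by auto
  show thesis
  proof (rule that[of f])
    show "f (x + y) = f x + f y" if "x \<in> V" "y \<in> V" for x y
      using f[OF Gadd[OF fG fG]] that by blast
    show "f (t *\<^sub>R x) = t * f x" if "x \<in> V" for t x
      using f[OF Gscale[OF fG]] that by blast
    show "f x = y" if "x \<in> V" "(x, y) \<in> G0" for x y
      using f G0G that by blast
    show "f x \<le> c" if "x \<in> V" "(x, c) \<in> K" for x c
      using Gdom[OF fG] that by blast
  qed
qed

section \<open>Trace inequalities for weighted frames in the plane\<close>

text \<open>With \<open>c = \<bar>cos t\<bar>\<close> the difference of the two sides is \<open>(2 c - 1)\<^sup>2 (1 - c) (c + 2) / 9\<close>; it vanishes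
  at the angles 0 and 60 degrees between the extremal functionals of the hexagonal norm.\<close>

lemma abs_cos_le_trig_poly:
  "\<bar>cos (t::real)\<bar> \<le> 2/3 + 7/18 * cos (2 * t) - 1/18 * cos (4 * t)"
proof -
  define c where "c = \<bar>cos t\<bar>"
  have c: "0 \<le> c" "c \<le> 1" and c2: "(cos t)^2 = c^2" by (auto simp: c_def)
  have "cos (2 * t) = 2 * c^2 - 1" using cos_double_cos[of t] c2 by simp
  moreover have "cos (4 * t) = 2 * (2 * c^2 - 1)^2 - 1"
    using cos_double_cos[of "2 * t"] calculation by simp
  moreover have "0 \<le> (2 * c - 1)^2 * ((1 - c) * (c + 2))" using c by simp
  ultimately show ?thesis unfolding c_def[symmetric]
    by (simp add: power2_eq_square algebra_simps)
qed

text \<open>Summed against the weights, each cosine of a multiple of an angle difference becomes a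
  sum of two squared moments. The majorant and \<open>moment\<close> leave
  \<open>5/18 * W\<^sup>2 + 7/9 * D\<close>, and \<open>W2\<close> turns this into
  \<open>(5/9 + 7/9) * D\<close>.\<close>

lemma tight_frame_sum_le:
  fixes d a b :: "'i \<Rightarrow> real"
  assumes d: "\<And>i. i \<in> I \<Longrightarrow> 0 \<le> d i"
    and aa: "(\<Sum>i\<in>I. d i * (a i)\<^sup>2) = 1" and bb: "(\<Sum>i\<in>I. d i * (b i)\<^sup>2) = 1"
    and ab: "(\<Sum>i\<in>I. d i * (a i * b i)) = 0"
  shows "(\<Sum>i\<in>I. \<Sum>j\<in>I. d i * d j * \<bar>a i * a j + b i * b j\<bar>) \<le> 4/3 * (\<Sum>i\<in>I. d i)"
proof -
  have "\<exists>r \<theta>. 0 \<le> r \<and> a i = r * cos \<theta> \<and> b i = r * sin \<theta>" for i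
  proof -
    have "Complex (a i) (b i) = rcis (cmod (Complex (a i) (b i))) (Arg (Complex (a i) (b i)))"
      by (simp add: rcis_cmod_Arg)
    then show ?thesis
      by (metis complex.sel Re_rcis Im_rcis norm_ge_zero)
  qed
  then obtain r \<theta> where r: "\<And>i. 0 \<le> r i" and ai: "\<And>i. a i = r i * cos (\<theta> i)"
    and bi: "\<And>i. b i = r i * sin (\<theta> i)" by metis
  define W where "W = (\<Sum>i\<in>I. d i * r i)"
  define D where "D = (\<Sum>i\<in>I. d i)"
  define X where "X = (\<Sum>i\<in>I. d i * r i * cos (2 * \<theta> i))"
  define Y where "Y = (\<Sum>i\<in>I. d i * r i * sin (2 * \<theta> i))"
  define X' where "X' = (\<Sum>i\<in>I. d i * r i * cos (4 * \<theta> i))"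
  define Y' where "Y' = (\<Sum>i\<in>I. d i * r i * sin (4 * \<theta> i))"
  \<comment> \<open>\<open>q i\<close> is the inner product of \<open>(X, Y)\<close> with the vector
    of length \<open>r i\<close> at the doubled angle. The frame condition makes \<open>q\<close>
    orthogonal to \<open>r\<close> for the weights \<open>d\<close> (\<open>drq\<close>).\<close>
  define q where "q i = r i * (X * cos (2 * \<theta> i) + Y * sin (2 * \<theta> i))" for i
  have rr: "(\<Sum>i\<in>I. d i * (r i)\<^sup>2) = 2"
  proof -
    have "d i * (r i)\<^sup>2 = d i * (a i)\<^sup>2 + d i * (b i)\<^sup>2" for i
      using sin_cos_squared_add[of "\<theta> i"]
      by (simp add: ai bi power_mult_distrib flip: distrib_left)
    then show ?thesis using aa bb by (simp add: sum.distrib)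
  qed
  have cos0: "(\<Sum>i\<in>I. d i * (r i)\<^sup>2 * cos (2 * \<theta> i)) = 0"
  proof -
    have "d i * (r i)\<^sup>2 * cos (2 * \<theta> i) = d i * (a i)\<^sup>2 - d i * (b i)\<^sup>2" for i
      by (simp add: ai bi power_mult_distrib cos_double right_diff_distrib mult.assoc)
    then show ?thesis using aa bb by (simp add: sum_subtractf)
  qed
  have sin0: "(\<Sum>i\<in>I. d i * (r i)\<^sup>2 * sin (2 * \<theta> i)) = 0"
  proof -
    have "d i * (r i)\<^sup>2 * sin (2 * \<theta> i) = 2 * (d i * (a i * b i))" for i
      unfolding ai bi sin_double power2_eq_square by simp
    then show ?thesis by (simp only: sum_distrib_left[symmetric] ab mult_zero_right)
  qed
  have drq: "(\<Sum>i\<in>I. d i * r i * q i) = 0"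
  proof -
    have "d i * r i * q i = X * (d i * (r i)\<^sup>2 * cos (2 * \<theta> i)) + Y * (d i * (r i)\<^sup>2 * sin (2 * \<theta> i))" for i
      by (simp add: q_def power2_eq_square algebra_simps)
    then show ?thesis using cos0 sin0 by (simp add: sum.distrib flip: sum_distrib_left)
  qed
  have dq: "(\<Sum>i\<in>I. d i * q i) = X\<^sup>2 + Y\<^sup>2"
  proof -
    have "d i * q i = X * (d i * r i * cos (2 * \<theta> i)) + Y * (d i * r i * sin (2 * \<theta> i))" for i
      by (simp add: q_def algebra_simps)
    then show ?thesis
      by (simp add: sum.distrib power2_eq_square flip: sum_distrib_left X_def Y_def)
  qed
  have dqq: "(\<Sum>i\<in>I. d i * (q i)\<^sup>2) \<le> 2 * (X\<^sup>2 + Y\<^sup>2)"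
  proof -
    have "(q i)\<^sup>2 \<le> (r i)\<^sup>2 * (X\<^sup>2 + Y\<^sup>2)" for i
    proof -
      let ?c = "cos (2 * \<theta> i)" and ?s = "sin (2 * \<theta> i)"
      have "(X * ?c + Y * ?s)\<^sup>2 + (X * ?s - Y * ?c)\<^sup>2 = (X\<^sup>2 + Y\<^sup>2) * (?s\<^sup>2 + ?c\<^sup>2)"
        by algebra
      then have "(X * ?c + Y * ?s)\<^sup>2 \<le> X\<^sup>2 + Y\<^sup>2"
        using zero_le_power2[of "X * ?s - Y * ?c"] by (simp only: sin_cos_squared_add mult_1_right)
      then show ?thesis
        unfolding q_def power_mult_distrib by (rule mult_left_mono) simp
    qed
    then have "(\<Sum>i\<in>I. d i * (q i)\<^sup>2) \<le> (\<Sum>i\<in>I. d i * ((r i)\<^sup>2 * (X\<^sup>2 + Y\<^sup>2)))"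
      using d by (intro sum_mono mult_left_mono) auto
    also have "\<dots> = 2 * (X\<^sup>2 + Y\<^sup>2)"
      using rr by (simp add: sum_distrib_right[symmetric] mult.assoc[symmetric])
    finally show ?thesis .
  qed
  \<comment> \<open>\<open>X\<close> and \<open>Y\<close> can be large only when the weights \<open>r i\<close> are far from constant, because
    \<open>\<Sum>i\<in>I. d i * r i * q i\<close> vanishes\<close>
  have moment: "X\<^sup>2 + Y\<^sup>2 \<le> 2 * D - W\<^sup>2"
  proof -
    \<comment> \<open>The constant 1 is compared with a combination of the orthogonal functions
      \<open>r\<close> and \<open>q\<close>. Its projection coefficient on \<open>r\<close> is
      \<open>W/2\<close> because \<open>r\<close> has squared norm 2; the coefficient 1/2 at
      \<open>q\<close> is the best one for the upper bound \<open>dqq\<close>.\<close>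
    have "0 \<le> (\<Sum>i\<in>I. d i * (1 - W/2 * r i - q i / 2)\<^sup>2)"
      using d by (intro sum_nonneg) auto
    also have "\<dots> = (\<Sum>i\<in>I. d i + W\<^sup>2/4 * (d i * (r i)\<^sup>2) + 1/4 * (d i * (q i)\<^sup>2)
        - W * (d i * r i) - d i * q i + W/2 * (d i * r i * q i))"
      by (intro sum.cong refl) (simp add: power2_eq_square field_simps)
    also have "\<dots> = D + W\<^sup>2/4 * 2 + 1/4 * (\<Sum>i\<in>I. d i * (q i)\<^sup>2) - W * W - (X\<^sup>2 + Y\<^sup>2) + W/2 * 0"
      by (simp only: sum.distrib sum_subtractf sum_distrib_left[symmetric] rr drq dq
          flip: D_def W_def)
    finally show ?thesis using dqq by (simp add: power2_eq_square)
  qed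
  have W2: "W\<^sup>2 \<le> 2 * D"
    using moment sum_power2_ge_zero[of X Y] by linarith
  have square: "(\<Sum>i\<in>I. \<Sum>j\<in>I. k * (f i * f j)) = k * (\<Sum>i\<in>I. f i)\<^sup>2" for k and f :: "'i \<Rightarrow> real"
    unfolding power2_eq_square sum_product by (simp only: sum_distrib_left)
  have "(\<Sum>i\<in>I. \<Sum>j\<in>I. d i * d j * \<bar>a i * a j + b i * b j\<bar>)
      \<le> (\<Sum>i\<in>I. \<Sum>j\<in>I. 2/3 * ((d i * r i) * (d j * r j))
         + 7/18 * ((d i * r i * cos (2 * \<theta> i)) * (d j * r j * cos (2 * \<theta> j)))
         + 7/18 * ((d i * r i * sin (2 * \<theta> i)) * (d j * r j * sin (2 * \<theta> j)))
         - 1/18 * ((d i * r i * cos (4 * \<theta> i)) * (d j * r j * cos (4 * \<theta> j)))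
         - 1/18 * ((d i * r i * sin (4 * \<theta> i)) * (d j * r j * sin (4 * \<theta> j))))"
  proof (intro sum_mono)
    fix i j assume ij: "i \<in> I" "j \<in> I"
    have eq: "a i * a j + b i * b j = r i * r j * cos (\<theta> i - \<theta> j)"
      by (simp add: ai bi cos_diff algebra_simps)
    have "\<bar>a i * a j + b i * b j\<bar> = r i * r j * \<bar>cos (\<theta> i - \<theta> j)\<bar>"
      unfolding eq using r by (simp add: abs_mult)
    also have "\<dots> \<le> r i * r j * (2/3 + 7/18 * cos (2 * (\<theta> i - \<theta> j)) - 1/18 * cos (4 * (\<theta> i - \<theta> j)))"
      using r by (intro mult_left_mono abs_cos_le_trig_poly) auto
    finally have "d i * d j * \<bar>a i * a j + b i * b j\<bar> \<le> d i * d j * \<dots>"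
      using d ij by (intro mult_left_mono) auto
    moreover have "cos (2 * (\<theta> i - \<theta> j)) = cos (2 * \<theta> i) * cos (2 * \<theta> j) + sin (2 * \<theta> i) * sin (2 * \<theta> j)"
      "cos (4 * (\<theta> i - \<theta> j)) = cos (4 * \<theta> i) * cos (4 * \<theta> j) + sin (4 * \<theta> i) * sin (4 * \<theta> j)"
      by (simp_all add: right_diff_distrib cos_diff)
    ultimately show "d i * d j * \<bar>a i * a j + b i * b j\<bar> \<le> 2/3 * ((d i * r i) * (d j * r j))
         + 7/18 * ((d i * r i * cos (2 * \<theta> i)) * (d j * r j * cos (2 * \<theta> j)))
         + 7/18 * ((d i * r i * sin (2 * \<theta> i)) * (d j * r j * sin (2 * \<theta> j)))
         - 1/18 * ((d i * r i * cos (4 * \<theta> i)) * (d j * r j * cos (4 * \<theta> j)))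
         - 1/18 * ((d i * r i * sin (4 * \<theta> i)) * (d j * r j * sin (4 * \<theta> j)))"
      by (simp add: algebra_simps add_divide_distrib)
  qed
  also have "\<dots> = 2/3 * W\<^sup>2 + 7/18 * X\<^sup>2 + 7/18 * Y\<^sup>2 - 1/18 * X'\<^sup>2 - 1/18 * Y'\<^sup>2"
    by (simp only: sum.distrib sum_subtractf square
        flip: W_def X_def Y_def X'_def Y'_def)
  also have "\<dots> \<le> 2/3 * W\<^sup>2 + 7/18 * (2 * D - W\<^sup>2)"
    using mult_left_mono[OF moment, of "7/18"] zero_le_power2[of X'] zero_le_power2[of Y']
    unfolding distrib_left by linarith
  also have "\<dots> \<le> 4/3 * D"
    using W2 by (simp add: field_simps)
  finally show ?thesis by (simp add: D_def)
qed

text \<open>Here \<open>\<sigma> i j\<close> stands for the i-th functional at the j-th vector,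
  \<open>\<alpha>\<close> and \<open>\<beta>\<close> for the values of the functionals on a basis of
  the plane, and \<open>(p, q)\<close>, \<open>(p', q')\<close> for the images of the basis vectors.
  In an orthonormal basis the trace is the sum of \<open>d i * \<sigma> i j\<close> times the inner
  products of the frame vectors, and \<open>\<sigma> i j\<close> is at most \<open>d j\<close> in
  absolute value.\<close>

lemma trace_le_sum_weights:
  fixes d \<alpha> \<beta> :: "'i \<Rightarrow> real" and \<sigma> :: "'i \<Rightarrow> 'i \<Rightarrow> real"
  assumes d: "\<And>i. i \<in> I \<Longrightarrow> 0 \<le> d i"
    and \<sigma>: "\<And>i j. i \<in> I \<Longrightarrow> j \<in> I \<Longrightarrow> \<bar>\<sigma> i j\<bar> \<le> d j"
    and eq1: "\<And>i. i \<in> I \<Longrightarrow> (\<Sum>j\<in>I. \<alpha> j * \<sigma> i j) = \<alpha> i * p + \<beta> i * q"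
    and eq2: "\<And>i. i \<in> I \<Longrightarrow> (\<Sum>j\<in>I. \<beta> j * \<sigma> i j) = \<alpha> i * p' + \<beta> i * q'"
    and gram: "(\<Sum>i\<in>I. d i * (\<alpha> i * \<beta> i))\<^sup>2 < (\<Sum>i\<in>I. d i * (\<alpha> i)\<^sup>2) * (\<Sum>i\<in>I. d i * (\<beta> i)\<^sup>2)"
  shows "p + q' \<le> 4/3 * (\<Sum>i\<in>I. d i)"
proof -
  define A where "A = (\<Sum>i\<in>I. d i * (\<alpha> i)\<^sup>2)"
  define B where "B = (\<Sum>i\<in>I. d i * (\<alpha> i * \<beta> i))"
  define C where "C = (\<Sum>i\<in>I. d i * (\<beta> i)\<^sup>2)"
  \<comment> \<open>Gram-Schmidt for \<open>\<alpha>\<close>, \<open>\<beta>\<close> with weights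
    \<open>d\<close>. The vector \<open>A * \<beta> - B * \<alpha>\<close> is orthogonal to
    \<open>\<alpha>\<close> and has squared norm \<open>A * (A * C - B\<^sup>2)\<close>, which is
    positive by \<open>gram\<close>.\<close>
  define s where "s = sqrt A"
  define w where "w = sqrt (A * (A * C - B\<^sup>2))"
  define a where "a i = \<alpha> i / s" for i
  define b where "b i = (A * \<beta> i - B * \<alpha> i) / w" for i
  have "A \<ge> 0" unfolding A_def using d by (intro sum_nonneg) auto
  moreover have ACB: "B\<^sup>2 < A * C" using gram by (simp add: A_def B_def C_def)
  ultimately have A: "A > 0" by (cases "A = 0") auto
  have s: "s > 0" "s * s = A" using A by (auto simp: s_def)
  have w: "w > 0" "w * w = A * (A * C - B\<^sup>2)" using A ACB by (auto simp: w_def)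
  have aa: "(\<Sum>i\<in>I. d i * (a i)\<^sup>2) = 1"
  proof -
    have "d i * (a i)\<^sup>2 = d i * (\<alpha> i)\<^sup>2 / A" for i
      using s by (simp add: a_def power2_eq_square)
    then show ?thesis using A by (simp add: sum_divide_distrib[symmetric] A_def[symmetric])
  qed
  have ab: "(\<Sum>i\<in>I. d i * (a i * b i)) = 0"
  proof -
    have "d i * (a i * b i) = (A / (s * w)) * (d i * (\<alpha> i * \<beta> i)) - (B / (s * w)) * (d i * (\<alpha> i)\<^sup>2)" for i
      using s w by (simp add: a_def b_def power2_eq_square field_simps)
    then have "(\<Sum>i\<in>I. d i * (a i * b i)) = (A / (s * w)) * B - (B / (s * w)) * A"
      by (simp only: sum_subtractf sum_distrib_left[symmetric] A_def[symmetric] B_def[symmetric])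
    then show ?thesis by simp
  qed
  have bb: "(\<Sum>i\<in>I. d i * (b i)\<^sup>2) = 1"
  proof -
    have "d i * (b i)\<^sup>2 = (A\<^sup>2 * (d i * (\<beta> i)\<^sup>2) - 2 * A * B * (d i * (\<alpha> i * \<beta> i))
        + B\<^sup>2 * (d i * (\<alpha> i)\<^sup>2)) / (w * w)" for i
      using w(1) by (simp add: b_def power2_eq_square field_simps)
    then have "(\<Sum>i\<in>I. d i * (b i)\<^sup>2) = (A\<^sup>2 * C - 2 * A * B * B + B\<^sup>2 * A) / (w * w)"
      by (simp only: sum_subtractf sum.distrib sum_distrib_left[symmetric] sum_divide_distrib[symmetric]
          A_def[symmetric] B_def[symmetric] C_def[symmetric])
    also have "A\<^sup>2 * C - 2 * A * B * B + B\<^sup>2 * A = w * w"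
      unfolding w by (simp add: power2_eq_square algebra_simps)
    finally show ?thesis using w(1) by simp
  qed
  have \<alpha>: "\<alpha> i = s * a i" for i using s by (simp add: a_def)
  have \<beta>: "\<beta> i = (w * b i + B * s * a i) / A" for i
    using s(1) w(1) A by (simp add: a_def b_def field_simps)
  have row: "(\<Sum>j\<in>I. \<sigma> i j * (a i * a j + b i * b j))
      = a i * ((\<alpha> i * p + \<beta> i * q) / s) + b i * ((A * (\<alpha> i * p' + \<beta> i * q') - B * (\<alpha> i * p + \<beta> i * q)) / w)"
    if "i \<in> I" for i
  proof -
    have "\<sigma> i j * (a i * a j + b i * b j) = (a i / s - b i * B / w) * (\<alpha> j * \<sigma> i j) + (b i * A / w) * (\<beta> j * \<sigma> i j)" for j
      using s(1) w(1) by (simp add: a_def[of j] b_def[of j] field_simps)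
    then have "(\<Sum>j\<in>I. \<sigma> i j * (a i * a j + b i * b j))
        = (a i / s - b i * B / w) * (\<alpha> i * p + \<beta> i * q) + (b i * A / w) * (\<alpha> i * p' + \<beta> i * q')"
      by (simp only: sum.distrib sum_distrib_left[symmetric] eq1[OF that] eq2[OF that])
    also have "\<dots> = a i * ((\<alpha> i * p + \<beta> i * q) / s)
        + b i * ((A * (\<alpha> i * p' + \<beta> i * q') - B * (\<alpha> i * p + \<beta> i * q)) / w)"
      by (simp add: left_diff_distrib right_diff_distrib diff_divide_distrib mult_ac)
    finally show ?thesis .
  qed
  \<comment> \<open>The matrix of the operator in the orthonormalized basis: \<open>u\<close> and
    \<open>v\<close> are the diagonal entries, with the same sum \<open>p + q'\<close>. The
    off-diagonal \<open>k\<close> and \<open>l\<close> are multiplied by the vanishing sum in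
    \<open>ab\<close>.\<close>
  define u where "u = p + B * q / A"
  define v where "v = q' - B * q / A"
  define k where "k = w * q / (A * s)"
  define l where "l = (A * (s * p' + q' * B * s / A) - B * (s * p + q * B * s / A)) / w"
  have "p + q' = u * 1 + (k + l) * 0 + v * 1" by (simp add: u_def v_def)
  also have "\<dots> = (\<Sum>i\<in>I. u * (d i * (a i)\<^sup>2) + (k + l) * (d i * (a i * b i))
      + v * (d i * (b i)\<^sup>2))"
    by (simp only: sum.distrib sum_distrib_left[symmetric] aa ab bb)
  also have "\<dots> = (\<Sum>i\<in>I. d i * (\<Sum>j\<in>I. \<sigma> i j * (a i * a j + b i * b j)))"
  proof (intro sum.cong refl)
    fix i assume i: "i \<in> I"
    have ca: "a i * ((\<alpha> i * p + \<beta> i * q) / s) = u * (a i)\<^sup>2 + k * (a i * b i)"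
      unfolding \<alpha> \<beta> u_def k_def using s(1) A by (simp add: field_simps power2_eq_square)
    have cb: "b i * ((A * (\<alpha> i * p' + \<beta> i * q') - B * (\<alpha> i * p + \<beta> i * q)) / w)
        = v * (b i)\<^sup>2 + l * (a i * b i)"
      unfolding \<alpha> \<beta> v_def l_def using w(1) A by (simp add: field_simps power2_eq_square)
    show "u * (d i * (a i)\<^sup>2) + (k + l) * (d i * (a i * b i)) + v * (d i * (b i)\<^sup>2)
        = d i * (\<Sum>j\<in>I. \<sigma> i j * (a i * a j + b i * b j))"
      unfolding row[OF i] ca cb by algebra
  qed
  also have "\<dots> \<le> (\<Sum>i\<in>I. d i * (\<Sum>j\<in>I. d j * \<bar>a i * a j + b i * b j\<bar>))"
  proof (intro sum_mono mult_left_mono)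
    fix i j assume ij: "i \<in> I" "j \<in> I"
    have "\<sigma> i j * (a i * a j + b i * b j) \<le> \<bar>\<sigma> i j\<bar> * \<bar>a i * a j + b i * b j\<bar>"
      by (simp flip: abs_mult)
    also have "\<dots> \<le> d j * \<bar>a i * a j + b i * b j\<bar>"
      using \<sigma>[OF ij] by (intro mult_right_mono) auto
    finally show "\<sigma> i j * (a i * a j + b i * b j) \<le> d j * \<bar>a i * a j + b i * b j\<bar>" .
  qed (use d in auto)
  also have "\<dots> \<le> 4/3 * (\<Sum>i\<in>I. d i)"
    using tight_frame_sum_le[OF d aa bb ab] by (simp add: sum_distrib_left mult.assoc)
  finally show ?thesis .
qed

section \<open>Functionals of norm at most 1 on a normed carrier\<close>

definition dual_ball_on :: "'v::real_vector set \<Rightarrow> ('v \<Rightarrow> real) \<Rightarrow> ('v \<Rightarrow> real) set" where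
  "dual_ball_on V N = {f. (\<forall>x\<in>V. \<forall>y\<in>V. f (x + y) = f x + f y) \<and>
     (\<forall>t. \<forall>x\<in>V. f (t *\<^sub>R x) = t * f x) \<and> (\<forall>x\<in>V. \<bar>f x\<bar> \<le> N x)}"

context
  fixes V :: "'v::real_vector set" and N :: "'v \<Rightarrow> real"
  assumes normed: "normed_space_on V N"
begin

lemma normed_space_on_subspace: "subspace V"
  using normed by (simp add: normed_space_on_def)

lemma normed_space_on_nonneg: "x \<in> V \<Longrightarrow> 0 \<le> N x"
  using normed by (simp add: normed_space_on_def)

lemma normed_space_on_eq_0_iff: "x \<in> V \<Longrightarrow> N x = 0 \<longleftrightarrow> x = 0"
  using normed by (simp add: normed_space_on_def)

lemma normed_space_on_scale: "x \<in> V \<Longrightarrow> N (a *\<^sub>R x) = \<bar>a\<bar> * N x"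
  using normed by (simp add: normed_space_on_def)

lemma normed_space_on_triangle: "x \<in> V \<Longrightarrow> y \<in> V \<Longrightarrow> N (x + y) \<le> N x + N y"
  using normed by (simp add: normed_space_on_def)

lemma normed_space_on_zero: "N 0 = 0"
  using normed_space_on_eq_0_iff subspace_0[OF normed_space_on_subspace] by blast

lemma normed_space_on_comb: "x \<in> V \<Longrightarrow> y \<in> V \<Longrightarrow> s *\<^sub>R x + t *\<^sub>R y \<in> V"
  using normed_space_on_subspace by (simp add: subspace_add subspace_scale)

lemma dual_ball_sum:
  assumes "f \<in> dual_ball_on V N" "\<And>i. i \<in> I \<Longrightarrow> x i \<in> V"
  shows "f (\<Sum>i\<in>I. a i *\<^sub>R x i) = (\<Sum>i\<in>I. a i * f (x i))"
  using assms(2)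
proof (induction I rule: infinite_finite_induct)
  case (insert i I)
  have "(\<Sum>i\<in>I. a i *\<^sub>R x i) \<in> V" "a i *\<^sub>R x i \<in> V" "x i \<in> V"
    using insert.prems normed_space_on_subspace by (auto intro!: subspace_sum subspace_scale)
  then show ?case using insert assms(1) by (simp add: dual_ball_on_def)
next
  case empty
  have "f (0 *\<^sub>R 0) = 0 * f 0"
    using assms(1) subspace_0[OF normed_space_on_subspace] unfolding dual_ball_on_def by blast
  then show ?case by simp
next
  case (infinite I)
  have "f (0 *\<^sub>R 0) = 0 * f 0"
    using assms(1) subspace_0[OF normed_space_on_subspace] unfolding dual_ball_on_def by blast
  then show ?case using infinite by simp
qed

lemma dual_ball_comb:
  assumes "f \<in> dual_ball_on V N" "x \<in> V" "y \<in> V"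
  shows "f (s *\<^sub>R x + t *\<^sub>R y) = s * f x + t * f y"
  using assms normed_space_on_subspace by (simp add: dual_ball_on_def subspace_scale)

text \<open>The epigraph of \<open>N\<close> is a cone, and evenness of \<open>N\<close> upgrades
  the one-sided bound to \<open>\<bar>f x\<bar> \<le> N x\<close>.\<close>

lemma hahn_banach_on:
  assumes G0: "subspace G0" and dom: "\<And>x y. (x, y) \<in> G0 \<Longrightarrow> x \<in> V \<and> y \<le> N x"
  obtains f where "f \<in> dual_ball_on V N" "\<And>x y. (x, y) \<in> G0 \<Longrightarrow> f x = y"
proof -
  define K where "K = {(x, c). x \<in> V \<and> N x \<le> c}"
  obtain f where f: "\<And>x y. x \<in> V \<Longrightarrow> y \<in> V \<Longrightarrow> f (x + y) = f x + f y"
    "\<And>t x. x \<in> V \<Longrightarrow> f (t *\<^sub>R x) = t * f x"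
    "\<And>x y. x \<in> V \<Longrightarrow> (x, y) \<in> G0 \<Longrightarrow> f x = y"
    "\<And>x c. x \<in> V \<Longrightarrow> (x, c) \<in> K \<Longrightarrow> f x \<le> c"
  proof (rule cone_hahn_banach[OF normed_space_on_subspace G0, of K])
    show "(0, 0) \<in> K" by (simp add: K_def subspace_0 normed_space_on_subspace normed_space_on_zero)
    show "(x + y, c + d) \<in> K" if "(x, c) \<in> K" "(y, d) \<in> K" for x c y d
      using that normed_space_on_triangle[of x y] normed_space_on_subspace by (auto simp: K_def intro: subspace_add)
    show "(t *\<^sub>R x, t * c) \<in> K" if "t > 0" "(x, c) \<in> K" for t x c
      using that normed_space_on_subspace by (auto simp: K_def normed_space_on_scale intro: subspace_scale)
    show "\<exists>c. (x, c) \<in> K" if "x \<in> V" for x using that by (auto simp: K_def)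
    show "y \<le> c" if "(x, y) \<in> G0" "(x, c) \<in> K" for x y c
      using that dom[of x y] by (auto simp: K_def)
  qed blast
  have "\<bar>f x\<bar> \<le> N x" if x: "x \<in> V" for x
  proof -
    have "f x \<le> N x" using f(4)[OF x] x by (simp add: K_def)
    moreover have "f ((-1) *\<^sub>R x) \<le> N ((-1) *\<^sub>R x)"
      by (rule f(4)) (use x normed_space_on_subspace in \<open>auto simp: K_def subspace_neg\<close>)
    ultimately show ?thesis unfolding f(2)[OF x] normed_space_on_scale[OF x] by simp
  qed
  then have "f \<in> dual_ball_on V N" using f by (simp add: dual_ball_on_def)
  then show thesis using that f(3) dom by blast
qed

lemma dual_ball_norming:
  assumes z: "z \<in> V"
  obtains f where "f \<in> dual_ball_on V N" "f z = N z"
proof -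
  have "subspace (range (\<lambda>t. (t *\<^sub>R z, t * N z)))"
    by (intro linear_subspace_image subspace_UNIV linearI) (auto simp: algebra_simps)
  then obtain f where f: "f \<in> dual_ball_on V N"
    "\<And>x y. (x, y) \<in> range (\<lambda>t. (t *\<^sub>R z, t * N z)) \<Longrightarrow> f x = y"
  proof (rule hahn_banach_on)
    fix x y assume "(x, y) \<in> range (\<lambda>t. (t *\<^sub>R z, t * N z))"
    then show "x \<in> V \<and> y \<le> N x"
      using z normed_space_on_subspace normed_space_on_nonneg[OF z] by (auto simp: normed_space_on_scale subspace_scale intro!: mult_right_mono)
  qed blast
  have "(z, N z) \<in> range (\<lambda>t. (t *\<^sub>R z, t * N z))"
    by (rule image_eqI[of _ _ 1]) auto
  then show thesis using that f by blast
qed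

text \<open>The inequality \<open>le\<close> says that the prescribed values are dominated by
  \<open>N\<close> on the span of \<open>b1\<close> and \<open>b2\<close>; their graph, the range of
  \<open>g\<close>, is then extended.\<close>

lemma dual_ball_extend:
  assumes b: "b1 \<in> V" "b2 \<in> V" and le: "\<And>s t. \<bar>s * \<alpha> + t * \<beta>\<bar> \<le> N (s *\<^sub>R b1 + t *\<^sub>R b2)"
  obtains f where "f \<in> dual_ball_on V N" "f b1 = \<alpha>" "f b2 = \<beta>"
proof -
  define g where "g z = (fst z *\<^sub>R b1 + snd z *\<^sub>R b2, fst z * \<alpha> + snd z * \<beta>)" for z
  have "linear g"
    by (intro linearI) (auto simp: g_def algebra_simps)
  then have "subspace (range g)"
    by (intro linear_subspace_image subspace_UNIV)
  then obtain f where f: "f \<in> dual_ball_on V N" "\<And>x y. (x, y) \<in> range g \<Longrightarrow> f x = y"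
  proof (rule hahn_banach_on)
    fix x y assume "(x, y) \<in> range g"
    then obtain s t where "x = s *\<^sub>R b1 + t *\<^sub>R b2" "y = s * \<alpha> + t * \<beta>" by (auto simp: g_def)
    then show "x \<in> V \<and> y \<le> N x"
      using le[of s t] normed_space_on_comb[OF b, of s t] by simp
  qed blast
  have "(b1, \<alpha>) \<in> range g" "(b2, \<beta>) \<in> range g"
    by (rule image_eqI[of _ _ "(1, 0)"], simp_all add: g_def)
      (rule image_eqI[of _ _ "(0, 1)"], simp_all add: g_def)
  then show thesis using that f by blast
qed

text \<open>A weak form of an Auerbach basis, obtained without maximizing a determinant:
  \<open>b2\<close> is chosen in the kernel of a functional \<open>g1\<close> norming
  \<open>b1\<close>, so \<open>g1\<close> reads off the first coordinate. A functional norming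
  \<open>b2\<close> then controls the second coordinate up to the first one, whence the factor
  2.\<close>

lemma plane_basis:
  assumes E: "subspace E" "E \<subseteq> V" "dim E = 2"
  obtains b1 b2 where "b1 \<in> V" "b2 \<in> V" "E = span {b1, b2}" "N b1 = 1" "N b2 = 1"
    "\<And>s t. \<bar>s\<bar> \<le> N (s *\<^sub>R b1 + t *\<^sub>R b2)" "\<And>s t. \<bar>t\<bar> \<le> 2 * N (s *\<^sub>R b1 + t *\<^sub>R b2)"
proof -
  obtain B where B: "B \<subseteq> E" "independent B" "E \<subseteq> span B" "card B = 2"
    using basis_exists[of E] E(3) by metis
  then obtain e1 e2 where Be: "B = {e1, e2}" and ne: "e1 \<noteq> e2" by (auto simp: card_2_iff)
  have e: "e1 \<in> E" "e2 \<in> E" "e1 \<in> V" "e2 \<in> V" using B Be E by auto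
  have e1: "e1 \<noteq> 0" using B(2) Be dependent_zero by blast
  then have N1: "N e1 > 0" using normed_space_on_nonneg[OF e(3)] normed_space_on_eq_0_iff[OF e(3)] by linarith
  define b1 where "b1 = e1 /\<^sub>R N e1"
  have b1: "b1 \<in> E" "b1 \<in> V" "N b1 = 1"
    using e E N1 normed_space_on_subspace by (auto simp: b1_def subspace_scale normed_space_on_scale)
  obtain g1 where g1: "g1 \<in> dual_ball_on V N" "g1 b1 = 1"
    using dual_ball_norming[OF b1(2)] b1(3) by metis
  define e' where "e' = 1 *\<^sub>R e2 + (- g1 e2) *\<^sub>R b1"
  have e': "e' \<in> E" "e' \<in> V"
    using e b1 E normed_space_on_subspace by (auto simp: e'_def intro!: subspace_diff subspace_scale)
  have "e' \<noteq> 0"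
  proof
    assume "e' = 0"
    then have "e2 = (g1 e2 / N e1) *\<^sub>R e1" by (simp add: e'_def b1_def divide_inverse)
    then have "e2 \<in> span {e1}" by (metis span_base span_scale singletonI)
    moreover have "independent (insert e2 {e1})" using B(2) Be by (simp add: insert_commute)
    ultimately show False unfolding independent_insert using ne by (auto split: if_splits)
  qed
  then have N2: "N e' > 0" using normed_space_on_nonneg[OF e'(2)] normed_space_on_eq_0_iff[OF e'(2)] by linarith
  define b2 where "b2 = e' /\<^sub>R N e'"
  have b2: "b2 \<in> E" "b2 \<in> V" "N b2 = 1"
    using e' E N2 normed_space_on_subspace by (auto simp: b2_def subspace_scale normed_space_on_scale)
  have "g1 e' = 0"
    unfolding e'_def by (subst dual_ball_comb[OF g1(1)]) (use e b1 g1 in auto)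
  then have g1b2: "g1 b2 = 0"
    using g1(1) e' by (auto simp: b2_def dual_ball_on_def)
  obtain g2 where g2: "g2 \<in> dual_ball_on V N" "g2 b2 = 1"
    using dual_ball_norming[OF b2(2)] b2(3) by metis
  have coord1: "\<bar>s\<bar> \<le> N (s *\<^sub>R b1 + t *\<^sub>R b2)" for s t
  proof -
    have "g1 (s *\<^sub>R b1 + t *\<^sub>R b2) = s"
      using dual_ball_comb[OF g1(1) b1(2) b2(2), of s t] g1 g1b2 by simp
    then show ?thesis
      using g1(1) normed_space_on_comb[OF b1(2) b2(2), of s t] by (force simp: dual_ball_on_def)
  qed
  have coord2: "\<bar>t\<bar> \<le> 2 * N (s *\<^sub>R b1 + t *\<^sub>R b2)" for s t
  proof -
    have "g2 (s *\<^sub>R b1 + t *\<^sub>R b2) = s * g2 b1 + t"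
      using dual_ball_comb[OF g2(1) b1(2) b2(2), of s t] g2 by simp
    then have "\<bar>s * g2 b1 + t\<bar> \<le> N (s *\<^sub>R b1 + t *\<^sub>R b2)"
      using g2(1) normed_space_on_comb[OF b1(2) b2(2), of s t] by (force simp: dual_ball_on_def)
    moreover have "\<bar>g2 b1\<bar> \<le> 1" using g2(1) b1 by (force simp: dual_ball_on_def)
    then have "\<bar>s * g2 b1\<bar> \<le> \<bar>s\<bar>" by (simp add: abs_mult mult_left_le)
    ultimately show ?thesis using coord1[of s t] by linarith
  qed
  have "E = span {b1, b2}"
  proof
    show "span {b1, b2} \<subseteq> E" using b1 b2 E(1) by (simp add: span_minimal)
    have s: "b1 \<in> span {b1, b2}" "b2 \<in> span {b1, b2}" by (auto intro: span_base)
    have "e1 = N e1 *\<^sub>R b1" "e2 = N e' *\<^sub>R b2 + g1 e2 *\<^sub>R b1"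
      using N1 N2 by (auto simp: b1_def b2_def) (simp add: e'_def b1_def)
    then have "e1 \<in> span {b1, b2}" "e2 \<in> span {b1, b2}"
      using s by (metis span_add span_scale)+
    then have "span B \<subseteq> span {b1, b2}" unfolding Be by (simp add: span_minimal)
    then show "E \<subseteq> span {b1, b2}" using B(3) by blast
  qed
  then show thesis using that b1 b2 coord1 coord2 by blast
qed

section \<open>Trace against nuclear norm\<close>

text \<open>Each functional on the plane extends by Hahn-Banach to some \<open>g i\<close> on all of
  \<open>V\<close>, and the numbers \<open>g i (x j)\<close> are the matrix \<open>\<sigma>\<close>
  of \<open>trace_le_sum_weights\<close>.\<close>

lemma trace_le_nuclear_nondegenerate:
  fixes x :: "'i \<Rightarrow> 'v"
  assumes b: "b1 \<in> V" "b2 \<in> V" and x: "\<And>i. i \<in> I \<Longrightarrow> x i \<in> V"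
    and le: "\<And>i s t. i \<in> I \<Longrightarrow> \<bar>s * \<alpha> i + t * \<beta> i\<bar> \<le> N (s *\<^sub>R b1 + t *\<^sub>R b2)"
    and eq1: "(\<Sum>i\<in>I. \<alpha> i *\<^sub>R x i) = p *\<^sub>R b1 + q *\<^sub>R b2"
    and eq2: "(\<Sum>i\<in>I. \<beta> i *\<^sub>R x i) = p' *\<^sub>R b1 + q' *\<^sub>R b2"
    and gram: "(\<Sum>i\<in>I. N (x i) * (\<alpha> i * \<beta> i))\<^sup>2
      < (\<Sum>i\<in>I. N (x i) * (\<alpha> i)\<^sup>2) * (\<Sum>i\<in>I. N (x i) * (\<beta> i)\<^sup>2)"
  shows "p + q' \<le> 4/3 * (\<Sum>i\<in>I. N (x i))"
proof -
  have "\<exists>g. i \<in> I \<longrightarrow> g \<in> dual_ball_on V N \<and> g b1 = \<alpha> i \<and> g b2 = \<beta> i" for i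
    using dual_ball_extend[OF b le] by metis
  then obtain g where g: "\<And>i. i \<in> I \<Longrightarrow> g i \<in> dual_ball_on V N"
    "\<And>i. i \<in> I \<Longrightarrow> g i b1 = \<alpha> i" "\<And>i. i \<in> I \<Longrightarrow> g i b2 = \<beta> i"
    by metis
  show ?thesis
  proof (rule trace_le_sum_weights[where \<alpha> = \<alpha> and \<beta> = \<beta> and \<sigma> = "\<lambda>i j. g i (x j)"])
    show "0 \<le> N (x i)" if "i \<in> I" for i using normed_space_on_nonneg x that by blast
    show "\<bar>g i (x j)\<bar> \<le> N (x j)" if "i \<in> I" "j \<in> I" for i j
      using g(1)[OF that(1)] x[OF that(2)] by (simp add: dual_ball_on_def)
    show "(\<Sum>j\<in>I. \<alpha> j * g i (x j)) = \<alpha> i * p + \<beta> i * q" if i: "i \<in> I" for i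
      using dual_ball_sum[OF g(1)[OF i] x, of I "\<lambda>i. i" \<alpha>]
        dual_ball_comb[OF g(1)[OF i] b, of p q] g(2,3)[OF i] by (simp add: eq1 mult.commute)
    show "(\<Sum>j\<in>I. \<beta> j * g i (x j)) = \<alpha> i * p' + \<beta> i * q'" if i: "i \<in> I" for i
      using dual_ball_sum[OF g(1)[OF i] x, of I "\<lambda>i. i" \<beta>]
        dual_ball_comb[OF g(1)[OF i] b, of p' q'] g(2,3)[OF i] by (simp add: eq2 mult.commute)
  qed (rule gram)
qed

text \<open>A triple \<open>(x, \<alpha>, \<beta>)\<close> encodes the elementary tensor of \<open>x\<close> with the functional on
  \<open>span {b1, b2}\<close> that maps \<open>b1\<close> to \<open>\<alpha>\<close> and \<open>b2\<close> to \<open>\<beta>\<close>, which is required to have norm at most 1.\<close>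

definition contractive_terms :: "'v \<Rightarrow> 'v \<Rightarrow> ('v \<times> real \<times> real) set" where
  "contractive_terms b1 b2 =
     {(x, \<alpha>, \<beta>). x \<in> V \<and> (\<forall>s t. \<bar>s * \<alpha> + t * \<beta>\<bar> \<le> N (s *\<^sub>R b1 + t *\<^sub>R b2))}"

text \<open>By Cauchy-Schwarz the Gram matrix is always positive semidefinite, so an arbitrarily
  cheap perturbation of the representation, leaving the operator unchanged, reaches the
  nondegenerate case.\<close>

lemma trace_le_nuclear:
  assumes b: "b1 \<in> V" "b2 \<in> V" "N b1 = 1" "N b2 = 1"
    and coord: "\<And>s t. \<bar>s\<bar> \<le> N (s *\<^sub>R b1 + t *\<^sub>R b2)" "\<And>s t. \<bar>t\<bar> \<le> 2 * N (s *\<^sub>R b1 + t *\<^sub>R b2)"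
    and zs: "set zs \<subseteq> contractive_terms b1 b2"
    and eq1: "(\<Sum>(x, \<alpha>, \<beta>)\<leftarrow>zs. \<alpha> *\<^sub>R x) = p *\<^sub>R b1 + q *\<^sub>R b2"
    and eq2: "(\<Sum>(x, \<alpha>, \<beta>)\<leftarrow>zs. \<beta> *\<^sub>R x) = p' *\<^sub>R b1 + q' *\<^sub>R b2"
  shows "p + q' \<le> 4/3 * (\<Sum>(x, \<alpha>, \<beta>)\<leftarrow>zs. N x)"
proof -
  have nth: "(\<Sum>z\<leftarrow>ys. f z) = (\<Sum>i<length ys. f (ys ! i))" for ys and f :: "_ \<Rightarrow> 'b::comm_monoid_add"
    by (simp add: sum_list_sum_nth atLeast0LessThan)
  define A where "A ys = (\<Sum>(x, \<alpha>, \<beta>)\<leftarrow>ys. N x * \<alpha>\<^sup>2)" for ys :: "('v \<times> real \<times> real) list"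
  define B where "B ys = (\<Sum>(x, \<alpha>, \<beta>)\<leftarrow>ys. N x * (\<alpha> * \<beta>))" for ys :: "('v \<times> real \<times> real) list"
  define C where "C ys = (\<Sum>(x, \<alpha>, \<beta>)\<leftarrow>ys. N x * \<beta>\<^sup>2)" for ys :: "('v \<times> real \<times> real) list"
  have nondeg: "p + q' \<le> 4/3 * (\<Sum>(x, \<alpha>, \<beta>)\<leftarrow>ys. N x)"
    if ys: "set ys \<subseteq> contractive_terms b1 b2"
      and y1: "(\<Sum>(x, \<alpha>, \<beta>)\<leftarrow>ys. \<alpha> *\<^sub>R x) = p *\<^sub>R b1 + q *\<^sub>R b2"
      and y2: "(\<Sum>(x, \<alpha>, \<beta>)\<leftarrow>ys. \<beta> *\<^sub>R x) = p' *\<^sub>R b1 + q' *\<^sub>R b2"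
      and gram: "(B ys)\<^sup>2 < A ys * C ys" for ys
  proof -
    have mem: "ys ! i \<in> contractive_terms b1 b2" if "i < length ys" for i
      using ys that by auto
    have "p + q' \<le> 4/3 * (\<Sum>i<length ys. N (fst (ys ! i)))"
    proof (rule trace_le_nuclear_nondegenerate[OF b(1,2),
          where \<alpha> = "\<lambda>i. fst (snd (ys ! i))" and \<beta> = "\<lambda>i. snd (snd (ys ! i))"
            and p = p and q = q and p' = p' and q' = q'])
      show "fst (ys ! i) \<in> V" if "i \<in> {..<length ys}" for i
        using mem[of i] that by (auto simp: contractive_terms_def)
      show "\<bar>s * fst (snd (ys ! i)) + t * snd (snd (ys ! i))\<bar> \<le> N (s *\<^sub>R b1 + t *\<^sub>R b2)"
        if "i \<in> {..<length ys}" for i s t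
        using mem[of i] that by (auto simp: contractive_terms_def)
    qed (use y1 y2 gram in \<open>simp_all add: nth split_beta A_def B_def C_def\<close>)
    then show ?thesis by (simp add: nth split_beta)
  qed
  have Nz: "0 \<le> N (fst (zs ! i))" if "i < length zs" for i
    using nth_mem[OF that] zs normed_space_on_nonneg by (auto simp: contractive_terms_def)
  have "(B zs)\<^sup>2 \<le> A zs * C zs"
  proof -
    define r u v where "r i = sqrt (N (fst (zs ! i)))" and "u i = fst (snd (zs ! i))"
      and "v i = snd (snd (zs ! i))" for i
    have r: "N (fst (zs ! i)) = r i * r i" if "i < length zs" for i
      using Nz[OF that] by (simp add: r_def)
    have "A zs = (\<Sum>i<length zs. (r i * u i)\<^sup>2)" "C zs = (\<Sum>i<length zs. (r i * v i)\<^sup>2)"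
      "B zs = (\<Sum>i<length zs. (r i * u i) * (r i * v i))"
      unfolding A_def B_def C_def nth
      by (intro sum.cong refl; simp add: split_beta r u_def v_def power2_eq_square)+
    then show ?thesis by (simp only: Cauchy_Schwarz_ineq_sum)
  qed
  moreover have "0 \<le> A zs" "0 \<le> C zs"
    unfolding A_def C_def nth using Nz by (auto simp: split_beta intro!: sum_nonneg)
  ultimately have gram0: "(B zs)\<^sup>2 < (A zs + 2 * \<epsilon>) * (C zs + \<epsilon> / 2)" if "\<epsilon> > 0" for \<epsilon>
  proof -
    have "0 \<le> A zs * (\<epsilon> / 2)" "0 \<le> C zs * (2 * \<epsilon>)" "0 < \<epsilon> * \<epsilon>"
      using \<open>0 \<le> A zs\<close> \<open>0 \<le> C zs\<close> that by auto
    then show ?thesis using \<open>(B zs)\<^sup>2 \<le> A zs * C zs\<close> by (simp add: algebra_simps)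
  qed
  have bound: "p + q' \<le> 4/3 * (\<Sum>(x, \<alpha>, \<beta>)\<leftarrow>zs. N x) + \<epsilon>" if e: "\<epsilon> > 0" for \<epsilon>
  proof -
    \<comment> \<open>Four added terms of norm \<open>\<delta>\<close> cost
      \<open>4/3 * 4 * \<delta> = \<epsilon>\<close>. The functional \<open>(0, 1/2)\<close> is
      halved because the second coordinate is only bounded by \<open>2 * N\<close>; hence the
      increments \<open>2 * \<delta>\<close> of \<open>A\<close> and \<open>\<delta> / 2\<close> of
      \<open>C\<close>.\<close>
    define \<delta> where "\<delta> = 3/16 * \<epsilon>"
    have d: "\<delta> > 0" using e by (simp add: \<delta>_def)
    \<comment> \<open>adding cancelling terms of small norm makes the Gram matrix positive definite\<close>
    define ys where "ys = [(\<delta> *\<^sub>R b1, 1, 0), ((-\<delta>) *\<^sub>R b1, 1, 0), (\<delta> *\<^sub>R b2, 0, 1/2), ((-\<delta>) *\<^sub>R b2, 0, 1/2)] @ zs"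
    have Nd: "N (\<delta> *\<^sub>R b1) = \<delta>" "N ((-\<delta>) *\<^sub>R b1) = \<delta>" "N (\<delta> *\<^sub>R b2) = \<delta>" "N ((-\<delta>) *\<^sub>R b2) = \<delta>"
      using d b by (simp_all only: normed_space_on_scale abs_minus abs_of_pos mult_1_right)
    have "p + q' \<le> 4/3 * (\<Sum>(x, \<alpha>, \<beta>)\<leftarrow>ys. N x)"
    proof (rule nondeg)
      have V: "c *\<^sub>R b1 \<in> V" "c *\<^sub>R b2 \<in> V" for c
        using b normed_space_on_subspace by (auto intro: subspace_scale)
      have "\<bar>t\<bar> / 2 \<le> N (s *\<^sub>R b1 + t *\<^sub>R b2)" for s t
        using coord(2)[of t s] by simp
      then show "set ys \<subseteq> contractive_terms b1 b2"
        unfolding ys_def contractive_terms_def using V zs coord(1)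
        by (auto simp: contractive_terms_def simp del: scaleR_minus_left)
      show "(\<Sum>(x, \<alpha>, \<beta>)\<leftarrow>ys. \<alpha> *\<^sub>R x) = p *\<^sub>R b1 + q *\<^sub>R b2"
        "(\<Sum>(x, \<alpha>, \<beta>)\<leftarrow>ys. \<beta> *\<^sub>R x) = p' *\<^sub>R b1 + q' *\<^sub>R b2"
        using eq1 eq2 by (simp_all add: ys_def)
      have "A ys = A zs + 2 * \<delta>" "B ys = B zs" "C ys = C zs + \<delta> / 2"
        unfolding A_def B_def C_def ys_def by (simp_all add: Nd power2_eq_square del: scaleR_minus_left)
      then show "(B ys)\<^sup>2 < A ys * C ys" using gram0[OF d] by simp
    qed
    also have "(\<Sum>(x, \<alpha>, \<beta>)\<leftarrow>ys. N x) = (\<Sum>(x, \<alpha>, \<beta>)\<leftarrow>zs. N x) + 4 * \<delta>"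
      unfolding ys_def by (simp add: Nd del: scaleR_minus_left)
    finally show ?thesis by (simp add: \<delta>_def)
  qed
  show ?thesis by (rule field_le_epsilon) (rule bound)
qed

section \<open>Construction of the projection\<close>

text \<open>A pair \<open>(x, y)\<close> in \<open>V \<times> V\<close> stands for the operator on
  the plane taking \<open>b1\<close> to \<open>x\<close> and \<open>b2\<close> to \<open>y\<close>.
  The trace of operators into the plane is dominated by 4/3 times the nuclear norm; an extension
  \<open>L\<close> to all pairs has the form "trace after \<open>P\<close>", and this
  \<open>P\<close> is the projection.\<close>

lemma ex_projection_on_plane:
  assumes E: "subspace E" "E \<subseteq> V" "dim E = 2"
  shows "\<exists>P. projection_on V N E P \<and> op_norm_on V N P \<le> 4/3"
proof -
  have V: "subspace V" by (rule normed_space_on_subspace)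
  obtain b1 b2 where b: "b1 \<in> V" "b2 \<in> V" "N b1 = 1" "N b2 = 1" and Eb: "E = span {b1, b2}"
    and coord: "\<And>s t. \<bar>s\<bar> \<le> N (s *\<^sub>R b1 + t *\<^sub>R b2)" "\<And>s t. \<bar>t\<bar> \<le> 2 * N (s *\<^sub>R b1 + t *\<^sub>R b2)"
    using plane_basis[OF E] by metis
  define T where "T = contractive_terms b1 b2"
  \<comment> \<open>A list in \<open>T\<close> represents the pair as a sum of elementary tensors;
    \<open>c\<close> bounds 4/3 times the total norm of one such list.\<close>
  define K where "K = {((x, y), c) | x y c. \<exists>zs. set zs \<subseteq> T \<and> (\<Sum>(x, \<alpha>, \<beta>)\<leftarrow>zs. \<alpha> *\<^sub>R x) = x \<and>
     (\<Sum>(x, \<alpha>, \<beta>)\<leftarrow>zs. \<beta> *\<^sub>R x) = y \<and> 4/3 * (\<Sum>(x, \<alpha>, \<beta>)\<leftarrow>zs. N x) \<le> c}"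
  have KI: "((x, y), c) \<in> K" if "set zs \<subseteq> T" "(\<Sum>(x, \<alpha>, \<beta>)\<leftarrow>zs. \<alpha> *\<^sub>R x) = x"
     "(\<Sum>(x, \<alpha>, \<beta>)\<leftarrow>zs. \<beta> *\<^sub>R x) = y" "4/3 * (\<Sum>(x, \<alpha>, \<beta>)\<leftarrow>zs. N x) \<le> c" for x y c zs
    using that unfolding K_def by blast
  have KE: "\<exists>zs. set zs \<subseteq> T \<and> (\<Sum>(x, \<alpha>, \<beta>)\<leftarrow>zs. \<alpha> *\<^sub>R x) = fst x \<and>
     (\<Sum>(x, \<alpha>, \<beta>)\<leftarrow>zs. \<beta> *\<^sub>R x) = snd x \<and> 4/3 * (\<Sum>(x, \<alpha>, \<beta>)\<leftarrow>zs. N x) \<le> c"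
    if "(x, c) \<in> K" for x c
    using that unfolding K_def by auto
  \<comment> \<open>The range of \<open>g\<close> is the graph of the trace on operators from the
    plane to itself.\<close>
  define g where "g z = (case z of (p, q, p', q') \<Rightarrow>
      ((p *\<^sub>R b1 + q *\<^sub>R b2, p' *\<^sub>R b1 + q' *\<^sub>R b2), p + q'))" for z :: "real \<times> real \<times> real \<times> real"
  have "linear g"
    by (intro linearI) (auto simp: g_def algebra_simps)
  then have G0: "subspace (range g)"
    by (intro linear_subspace_image subspace_UNIV)
  have VV: "subspace (V \<times> V)" using V by (rule subspace_Times[OF _ V])
  obtain L where Ladd: "\<And>x y. x \<in> V \<times> V \<Longrightarrow> y \<in> V \<times> V \<Longrightarrow> L (x + y) = L x + L y"
    and Lscale: "\<And>t x. x \<in> V \<times> V \<Longrightarrow> L (t *\<^sub>R x) = t * L x"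
    and Lg: "\<And>x y. x \<in> V \<times> V \<Longrightarrow> (x, y) \<in> range g \<Longrightarrow> L x = y"
    and LK: "\<And>x c. x \<in> V \<times> V \<Longrightarrow> (x, c) \<in> K \<Longrightarrow> L x \<le> c"
  proof (rule cone_hahn_banach[OF VV G0, of K])
    show "(0, 0) \<in> K"
      unfolding zero_prod_def by (rule KI[of "[]"]) auto
    show "(x + y, c + d) \<in> K" if xc: "(x, c) \<in> K" and yd: "(y, d) \<in> K" for x c y d
    proof -
      obtain zs where zs: "set zs \<subseteq> T" "(\<Sum>(x, \<alpha>, \<beta>)\<leftarrow>zs. \<alpha> *\<^sub>R x) = fst x"
        "(\<Sum>(x, \<alpha>, \<beta>)\<leftarrow>zs. \<beta> *\<^sub>R x) = snd x" "4/3 * (\<Sum>(x, \<alpha>, \<beta>)\<leftarrow>zs. N x) \<le> c"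
        using KE[OF xc] by blast
      obtain ys where ys: "set ys \<subseteq> T" "(\<Sum>(x, \<alpha>, \<beta>)\<leftarrow>ys. \<alpha> *\<^sub>R x) = fst y"
        "(\<Sum>(x, \<alpha>, \<beta>)\<leftarrow>ys. \<beta> *\<^sub>R x) = snd y" "4/3 * (\<Sum>(x, \<alpha>, \<beta>)\<leftarrow>ys. N x) \<le> d"
        using KE[OF yd] by blast
      have "((fst x + fst y, snd x + snd y), c + d) \<in> K"
        by (rule KI[of "zs @ ys"]) (use zs ys in auto)
      then show ?thesis by (simp add: plus_prod_def)
    qed
    show "(t *\<^sub>R x, t * c) \<in> K" if t: "t > 0" and x: "(x, c) \<in> K" for t x c
    proof -
      obtain zs where zs: "set zs \<subseteq> T" "(\<Sum>(x, \<alpha>, \<beta>)\<leftarrow>zs. \<alpha> *\<^sub>R x) = fst x"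
        "(\<Sum>(x, \<alpha>, \<beta>)\<leftarrow>zs. \<beta> *\<^sub>R x) = snd x" "4/3 * (\<Sum>(x, \<alpha>, \<beta>)\<leftarrow>zs. N x) \<le> c"
        using KE[OF x] by blast
      define ys where "ys = map (\<lambda>(x, \<alpha>, \<beta>). (t *\<^sub>R x, \<alpha>, \<beta>)) zs"
      have s: "set ys \<subseteq> T"
        using zs(1) V by (fastforce simp: ys_def T_def contractive_terms_def intro: subspace_scale)
      have 1: "(\<Sum>(x, \<alpha>, \<beta>)\<leftarrow>ys. \<alpha> *\<^sub>R x) = t *\<^sub>R (\<Sum>(x, \<alpha>, \<beta>)\<leftarrow>zs. \<alpha> *\<^sub>R x)"
        unfolding ys_def by (induction zs) (auto simp: algebra_simps)
      have 2: "(\<Sum>(x, \<alpha>, \<beta>)\<leftarrow>ys. \<beta> *\<^sub>R x) = t *\<^sub>R (\<Sum>(x, \<alpha>, \<beta>)\<leftarrow>zs. \<beta> *\<^sub>R x)"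
        unfolding ys_def by (induction zs) (auto simp: algebra_simps)
      have 3: "(\<Sum>(x, \<alpha>, \<beta>)\<leftarrow>ys. N x) = t * (\<Sum>(x, \<alpha>, \<beta>)\<leftarrow>zs. N x)"
        unfolding ys_def using zs(1) t
        by (induction zs) (auto simp: algebra_simps T_def contractive_terms_def normed_space_on_scale)
      have "((t *\<^sub>R fst x, t *\<^sub>R snd x), t * c) \<in> K"
        by (rule KI[OF s]) (use 1 2 3 zs t mult_left_mono[OF zs(4), of t] in auto)
      then show ?thesis by (simp add: scaleR_prod_def)
    qed
    show "\<exists>c. (x, c) \<in> K" if "x \<in> V \<times> V" for x
    proof -
      \<comment> \<open>Every pair has a two-term representation: the second coordinate functional
        may have norm 2, so it is halved and the vector doubled.\<close>
      have "\<bar>t\<bar> / 2 \<le> N (s *\<^sub>R b1 + t *\<^sub>R b2)" for s t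
        using coord(2)[of t s] by simp
      then have "set [(fst x, 1, 0), (2 *\<^sub>R snd x, 0, 1/2)] \<subseteq> T"
        using that coord(1) V by (auto simp: T_def contractive_terms_def intro: subspace_scale)
      then have "((fst x, snd x), 4/3 * (N (fst x) + N (2 *\<^sub>R snd x))) \<in> K"
        by (rule KI) auto
      then show ?thesis by auto
    qed
    show "y \<le> c" if y: "(x, y) \<in> range g" and c: "(x, c) \<in> K" for x y c
    proof -
      obtain p q p' q' where pq: "fst x = p *\<^sub>R b1 + q *\<^sub>R b2" "snd x = p' *\<^sub>R b1 + q' *\<^sub>R b2" "y = p + q'"
        using y by (auto simp: g_def)
      obtain zs where zs: "set zs \<subseteq> T" "(\<Sum>(x, \<alpha>, \<beta>)\<leftarrow>zs. \<alpha> *\<^sub>R x) = fst x"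
        "(\<Sum>(x, \<alpha>, \<beta>)\<leftarrow>zs. \<beta> *\<^sub>R x) = snd x" "4/3 * (\<Sum>(x, \<alpha>, \<beta>)\<leftarrow>zs. N x) \<le> c"
        using KE[OF c] by blast
      show ?thesis
        using trace_le_nuclear[OF b coord zs(1)[unfolded T_def], of p q p' q'] zs pq by simp
    qed
  qed blast
  define P where "P v = L (v, 0) *\<^sub>R b1 + L (0, v) *\<^sub>R b2" for v
  have V0: "0 \<in> V" using V by (rule subspace_0)
  have L1add: "L (x + y, 0) = L (x, 0) + L (y, 0)" "L (0, x + y) = L (0, x) + L (0, y)"
    if "x \<in> V" "y \<in> V" for x y
    using Ladd[of "(x, 0)" "(y, 0)"] Ladd[of "(0, x)" "(0, y)"] that V0 by simp_all
  have L1scale: "L (t *\<^sub>R x, 0) = t * L (x, 0)" "L (0, t *\<^sub>R x) = t * L (0, x)"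
    if "x \<in> V" for t x
    using Lscale[of "(x, 0)" t] Lscale[of "(0, x)" t] that V0 by simp_all
  have Padd: "P (x + y) = P x + P y" if "x \<in> V" "y \<in> V" for x y
    by (simp add: P_def L1add[OF that] algebra_simps)
  have Pscale: "P (t *\<^sub>R x) = t *\<^sub>R P x" if "x \<in> V" for t x
    by (simp add: P_def L1scale[OF that] algebra_simps)
  \<comment> \<open>The traces of the four matrix units, which say that \<open>P\<close> fixes
    \<open>b1\<close> and \<open>b2\<close>.\<close>
  have "L (b1, 0) = 1" "L (b2, 0) = 0" "L (0, b1) = 0" "L (0, b2) = 1"
    by (rule Lg; use b V0 rangeI[of g "(1, 0, 0, 0)"] rangeI[of g "(0, 1, 0, 0)"]
        rangeI[of g "(0, 0, 1, 0)"] rangeI[of g "(0, 0, 0, 1)"] in \<open>simp add: g_def\<close>)+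
  then have Pb: "P b1 = b1" "P b2 = b2" by (simp_all add: P_def)
  have Pid: "P e = e" if eE: "e \<in> E" for e
  proof -
    obtain s t where "e - s *\<^sub>R b1 = t *\<^sub>R b2"
      using eE unfolding Eb span_insert[of b1] span_singleton by blast
    then have e: "e = s *\<^sub>R b1 + t *\<^sub>R b2" by (simp add: diff_eq_eq add.commute)
    have "s *\<^sub>R b1 \<in> V" "t *\<^sub>R b2 \<in> V" using b V by (auto intro: subspace_scale)
    then show ?thesis unfolding e by (simp add: Padd Pscale b Pb)
  qed
  have PE: "P v \<in> E" for v
    unfolding P_def Eb by (intro span_add span_scale span_base) auto
  have PV: "P ` V = E" using PE Pid E(2) by force
  \<comment> \<open>With \<open>f\<close> norming \<open>P v\<close>, the single tensor of
    \<open>v\<close> and \<open>f\<close> restricted to the plane costs \<open>4/3 * N v\<close>,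
    while \<open>L\<close> takes the value \<open>f (P v) = N (P v)\<close> on it.\<close>
  have PN: "N (P v) \<le> 4/3 * N v" if v: "v \<in> V" for v
  proof -
    obtain f where f: "f \<in> dual_ball_on V N" "f (P v) = N (P v)"
      using dual_ball_norming[of "P v"] PE E(2) by blast
    have "set [(v, f b1, f b2)] \<subseteq> T"
    proof -
      have "\<bar>s * f b1 + t * f b2\<bar> \<le> N (s *\<^sub>R b1 + t *\<^sub>R b2)" for s t
        using dual_ball_comb[OF f(1) b(1,2), of s t] f(1) normed_space_on_comb[OF b(1,2), of s t]
        by (force simp: dual_ball_on_def)
      then show ?thesis using v by (auto simp: T_def contractive_terms_def)
    qed
    then have "((f b1 *\<^sub>R v, f b2 *\<^sub>R v), 4/3 * N v) \<in> K"
      by (rule KI) auto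
    then have "L (f b1 *\<^sub>R v, f b2 *\<^sub>R v) \<le> 4/3 * N v"
      by (rule LK[rotated]) (use v V in \<open>auto intro: subspace_scale\<close>)
    moreover have "L (f b1 *\<^sub>R v, f b2 *\<^sub>R v) = f b1 * L (v, 0) + f b2 * L (0, v)"
    proof -
      have "f b1 *\<^sub>R v \<in> V" "f b2 *\<^sub>R v \<in> V" using v V by (auto intro: subspace_scale)
      then show ?thesis
        using Ladd[of "(f b1 *\<^sub>R v, 0)" "(0, f b2 *\<^sub>R v)"] V0 L1scale[OF v] by simp
    qed
    moreover have "N (P v) = L (v, 0) * f b1 + L (0, v) * f b2"
      using dual_ball_comb[OF f(1) b(1,2), of "L (v, 0)" "L (0, v)"] f(2) by (simp add: P_def)
    ultimately show ?thesis by (simp add: mult.commute)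
  qed
  have "projection_on V N E P"
    unfolding projection_on_def bounded_linear_on_def
    by (intro conjI ballI allI exI[of _ "4/3"] PV Pid Padd Pscale PN) (simp_all add: PV E(2))
  moreover have "op_norm_on V N P \<le> 4/3"
    unfolding op_norm_on_def
  proof (rule cSUP_least)
    show "{x \<in> V. N x \<le> 1} \<noteq> {}" using V0 normed_space_on_zero by force
    show "N (P x) \<le> 4/3" if "x \<in> {x \<in> V. N x \<le> 1}" for x
      using PN[of x] that by auto
  qed
  ultimately show ?thesis by blast
qed

end

lemma projection_bound_plane: "projection_bound TYPE('v::real_vector) 2 (4/3)"
  unfolding projection_bound_def using ex_projection_on_plane by blast

lemma ex_bounded_linear_projection_on_plane:
  fixes E :: "'a::real_normed_vector set"
  assumes "subspace E" "dim E = 2"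
  shows "\<exists>P. bounded_linear P \<and> range P = E \<and> (\<forall>e\<in>E. P e = e) \<and> onorm P \<le> 4/3"
proof -
  have "normed_space_on (UNIV :: 'a set) norm"
    by (auto simp: normed_space_on_def norm_triangle_ineq)
  then obtain P where P: "projection_on UNIV norm E P" "op_norm_on UNIV norm P \<le> 4/3"
    using ex_projection_on_plane[of UNIV norm E] assms by blast
  then have bl: "bounded_linear P"
    by (auto simp: projection_on_def bounded_linear_on_def bounded_linear_def linear_iff
        bounded_linear_axioms_def mult.commute)
  \<comment> \<open>A real supremum is known to dominate the members of the set only once the set is
    bounded above.\<close>
  have bdd: "bdd_above ((\<lambda>x. norm (P x)) ` {x \<in> UNIV. norm x \<le> 1})"
  proof (rule bdd_aboveI2)
    fix x :: 'a assume "x \<in> {x \<in> UNIV. norm x \<le> 1}"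
    then show "norm (P x) \<le> onorm P"
      using onorm[OF bl, of x] onorm_pos_le[OF bl] mult_left_le[of "norm x" "onorm P"] by auto
  qed
  have unit: "norm (P x) \<le> 4/3" if "norm x \<le> 1" for x
    using cSUP_upper[OF _ bdd, of x] P(2) that by (auto simp: op_norm_on_def)
  have "norm (P x) \<le> 4/3 * norm x" for x
  proof (cases "x = 0")
    case True then show ?thesis using linear_0[OF bounded_linear.linear[OF bl]] by simp
  next
    case False
    then show ?thesis
      using unit[of "x /\<^sub>R norm x"] linear_scale[OF bounded_linear.linear[OF bl], of "inverse (norm x)" x]
      by (simp add: field_simps)
  qed
  then have "onorm P \<le> 4/3" by (intro onorm_bound) auto
  then show ?thesis using P(1) bl by (auto simp: projection_on_def)
qed

section \<open>Lower bound from the hexagonal plane\<close>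

text \<open>Infinite dimension supplies three independent vectors, hence a copy of three-dimensional
  sup-norm space. A projection onto the sum-zero plane subtracts the coordinate sum times a vector
  \<open>u\<close> of coordinate sum 1, and three sign vectors test its norm.\<close>

lemma projection_bound_plane_ge:
  assumes inf: "\<nexists>B::'v::real_vector set. finite B \<and> span B = UNIV"
    and bound: "projection_bound TYPE('v) 2 c"
  shows "4/3 \<le> c"
proof -
  have ext: "\<exists>b. b \<notin> span B" if "finite B" for B :: "'v set"
    using inf that by blast
  obtain b1 :: 'v where b1: "b1 \<notin> span {}" using ext[of "{}"] by auto
  obtain b2 :: 'v where b2: "b2 \<notin> span {b1}" using ext[of "{b1}"] by auto
  obtain b3 :: 'v where b3: "b3 \<notin> span {b2, b1}" using ext[of "{b2, b1}"] by auto
  have ind: "independent {b3, b2, b1}"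
    using b1 b2 b3 by (auto simp: independent_insert span_base)
  have ne: "b1 \<noteq> b2" "b1 \<noteq> b3" "b2 \<noteq> b3"
    using b2 b3 span_base[of b1 "{b1}"] span_base[of _ "{b2, b1}"] by auto
  have coord: "\<exists>f. linear f \<and> f b1 = (if b1 = b then 1 else 0 :: real) \<and>
      f b2 = (if b2 = b then 1 else 0) \<and> f b3 = (if b3 = b then 1 else 0)" for b
    using linear_independent_extend[OF ind, of "\<lambda>x. if x = b then 1 else 0 :: real"] by auto
  obtain f1 :: "'v \<Rightarrow> real" where f1: "linear f1" "f1 b1 = 1" "f1 b2 = 0" "f1 b3 = 0"
    using coord[of b1] ne by metis
  obtain f2 :: "'v \<Rightarrow> real" where f2: "linear f2" "f2 b1 = 0" "f2 b2 = 1" "f2 b3 = 0"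
    using coord[of b2] ne by metis
  obtain f3 :: "'v \<Rightarrow> real" where f3: "linear f3" "f3 b1 = 0" "f3 b2 = 0" "f3 b3 = 1"
    using coord[of b3] ne by metis
  note lin = linear_add[OF f1(1)] linear_add[OF f2(1)] linear_add[OF f3(1)]
    linear_diff[OF f1(1)] linear_diff[OF f2(1)] linear_diff[OF f3(1)]
    linear_scale[OF f1(1)] linear_scale[OF f2(1)] linear_scale[OF f3(1)]
    linear_neg[OF f1(1)] linear_neg[OF f2(1)] linear_neg[OF f3(1)]
    linear_0[OF f1(1)] linear_0[OF f2(1)] linear_0[OF f3(1)] f1(2-) f2(2-) f3(2-)
  \<comment> \<open>the extremal plane: the coordinates with sum zero in three-dimensional \<open>l\<^sub>\<infinity>\<close>, with hexagonal unit ball\<close>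
  define h where "h v = f1 v *\<^sub>R b1 + f2 v *\<^sub>R b2 + f3 v *\<^sub>R b3" for v
  \<comment> \<open>\<open>V\<close> is the span of \<open>b1\<close>, \<open>b2\<close>,
    \<open>b3\<close>, written as the fixed points of \<open>h\<close> so that its vectors are
    determined by their three coordinates.\<close>
  define V where "V = {v. h v = v}"
  define N where "N v = max \<bar>f1 v\<bar> (max \<bar>f2 v\<bar> \<bar>f3 v\<bar>)" for v
  have V: "subspace V"
  proof -
    have "linear h" by (intro linearI) (auto simp: h_def lin algebra_simps)
    then show ?thesis
      unfolding V_def by (intro subspaceI) (auto simp: linear_0 linear_add linear_scale)
  qed
  have N_ge: "\<bar>f1 v\<bar> \<le> N v" "\<bar>f2 v\<bar> \<le> N v" "\<bar>f3 v\<bar> \<le> N v" for v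
    by (simp_all add: N_def)
  have normed: "normed_space_on V N"
    unfolding normed_space_on_def
  proof (intro conjI ballI allI)
    show "N x = 0 \<longleftrightarrow> x = 0" if "x \<in> V" for x
    proof
      assume "N x = 0"
      then have "f1 x = 0" "f2 x = 0" "f3 x = 0" by (auto simp: N_def max_def split: if_splits)
      with that show "x = 0" by (simp add: V_def h_def)
    qed (simp add: N_def lin)
    show "N (a *\<^sub>R x) = \<bar>a\<bar> * N x" for a x
      by (simp add: N_def lin abs_mult max_mult_distrib_left)
    show "N (x + y) \<le> N x + N y" for x y
      unfolding N_def[of "x + y"] lin
      by (intro max.boundedI order_trans[OF abs_triangle_ineq add_mono] N_ge)
  qed (auto simp: V N_def)
  define E where "E = span {b1 - b3, b2 - b3}"
  have bV: "b1 \<in> V" "b2 \<in> V" "b3 \<in> V" by (simp_all add: V_def h_def lin)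
  have EV: "E \<subseteq> V"
    unfolding E_def using V bV by (intro span_minimal) (auto intro: subspace_diff)
  have dimE: "dim E = 2"
  proof -
    have n0: "b1 - b3 \<noteq> 0" "b1 \<noteq> b2" using ne by auto
    have "b2 - b3 \<notin> span {b1 - b3}"
    proof
      assume "b2 - b3 \<in> span {b1 - b3}"
      then obtain k where "b2 - b3 = k *\<^sub>R (b1 - b3)" by (auto simp: span_singleton)
      then have "f2 (b2 - b3) = f2 (k *\<^sub>R (b1 - b3))" by simp
      then show False by (simp add: lin)
    qed
    then have "independent {b2 - b3, b1 - b3}"
      using n0 by (simp add: independent_insert)
    then have "dim (span {b2 - b3, b1 - b3}) = card {b2 - b3, b1 - b3}"
      by (simp add: dim_eq_card_independent del: span_insert)
    then show ?thesis using n0 by (simp add: E_def insert_commute)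
  qed
  have Esum: "f1 e + f2 e + f3 e = 0" if "e \<in> E" for e
  proof -
    have "linear (\<lambda>v. f1 v + f2 v + f3 v)"
      by (intro linearI) (auto simp: lin algebra_simps)
    then show ?thesis
      by (rule linear_eq_0_on_span[of _ "{b1 - b3, b2 - b3}"]) (use that in \<open>auto simp: E_def lin\<close>)
  qed
  obtain P where P: "projection_on V N E P" "op_norm_on V N P \<le> c"
    using bound normed EV dimE unfolding projection_bound_def E_def by (metis subspace_span)
  have Pbd: "\<exists>k. \<forall>x\<in>V. N (P x) \<le> k * N x" and PV: "P ` V = E" and Pid: "\<forall>e\<in>E. P e = e"
    and Padd': "\<forall>x\<in>V. \<forall>y\<in>V. P (x + y) = P x + P y"
    and Pscale': "\<forall>t. \<forall>x\<in>V. P (t *\<^sub>R x) = t *\<^sub>R P x"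
    using P(1) unfolding projection_on_def bounded_linear_on_def by - (elim conjE, assumption)+
  note Padd = Padd'[rule_format] and Pscale = Pscale'[rule_format]
  from Pbd obtain k where k: "\<And>x. x \<in> V \<Longrightarrow> N (P x) \<le> k * N x" by metis
  have Nnn: "0 \<le> N x" for x by (simp add: N_def le_max_iff_disj)
  have "bdd_above ((\<lambda>x. N (P x)) ` {x \<in> V. N x \<le> 1})"
  proof (rule bdd_aboveI2)
    fix x assume x: "x \<in> {x \<in> V. N x \<le> 1}"
    then have "N (P x) \<le> k * N x" using k by simp
    also have "\<dots> \<le> \<bar>k\<bar> * 1" using x Nnn[of x] by (intro mult_mono) auto
    finally show "N (P x) \<le> \<bar>k\<bar>" by simp
  qed
  then have Pc: "N (P x) \<le> c" if "x \<in> V" "N x \<le> 1" for x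
    using cSUP_upper[of x "{x \<in> V. N x \<le> 1}" "\<lambda>x. N (P x)"] that P(2) by (simp add: op_norm_on_def)
  \<comment> \<open>\<open>u\<close> spans the kernel of \<open>P\<close> in \<open>V\<close> and
    thereby determines \<open>P\<close>.\<close>
  define u where "u = b3 - P b3"
  have "P b3 \<in> E" using PV bV by blast
  then have usum: "f1 u + f2 u + f3 u = 1" using Esum[of "P b3"] by (simp add: u_def lin)
  have P3: "P b3 = b3 - u" by (simp add: u_def)
  have Pdiff: "P (b - b3) = b - b3" if "b \<in> {b1, b2}" for b
  proof -
    have "b - b3 \<in> E" using that by (auto simp: E_def intro: span_base)
    then show ?thesis using Pid by blast
  qed
  have P12: "P b = b - u" if "b \<in> {b1, b2}" for b
  proof -
    have "b - b3 \<in> V" using that bV V by (auto intro: subspace_diff)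
    then have "P ((b - b3) + b3) = P (b - b3) + P b3" using bV by (intro Padd)
    then show ?thesis using Pdiff[OF that] P3 by simp
  qed
  have Pcomb: "P (r *\<^sub>R b1 + s *\<^sub>R b2 + t *\<^sub>R b3) = r *\<^sub>R b1 + s *\<^sub>R b2 + t *\<^sub>R b3 - (r + s + t) *\<^sub>R u" for r s t
  proof -
    have "r *\<^sub>R b1 \<in> V" "s *\<^sub>R b2 \<in> V" "t *\<^sub>R b3 \<in> V" "r *\<^sub>R b1 + s *\<^sub>R b2 \<in> V"
      using bV V by (auto intro: subspace_add subspace_scale)
    then have "P (r *\<^sub>R b1 + s *\<^sub>R b2 + t *\<^sub>R b3) = r *\<^sub>R P b1 + s *\<^sub>R P b2 + t *\<^sub>R P b3"
      by (simp only: Padd Pscale bV)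
    also have "\<dots> = r *\<^sub>R (b1 - u) + s *\<^sub>R (b2 - u) + t *\<^sub>R (b3 - u)"
      by (simp only: P12 P3 insert_iff refl simp_thms)
    finally show ?thesis by (simp add: algebra_simps)
  qed
  have test: "N (r *\<^sub>R b1 + s *\<^sub>R b2 + t *\<^sub>R b3 - (r + s + t) *\<^sub>R u) \<le> c"
    if "\<bar>r\<bar> \<le> 1" "\<bar>s\<bar> \<le> 1" "\<bar>t\<bar> \<le> 1" for r s t
    unfolding Pcomb[symmetric]
  proof (rule Pc)
    show "r *\<^sub>R b1 + s *\<^sub>R b2 + t *\<^sub>R b3 \<in> V"
      using bV V by (auto intro: subspace_add subspace_scale)
    show "N (r *\<^sub>R b1 + s *\<^sub>R b2 + t *\<^sub>R b3) \<le> 1" using that by (simp add: N_def lin)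
  qed
  \<comment> \<open>A sign vector with a single plus has coordinate sum -1, so \<open>P\<close> adds
    \<open>u\<close> to it and the positive coordinate grows to 1 plus that of \<open>u\<close>. The
    three inequalities add up to \<open>4 \<le> 3 * c\<close>.\<close>
  have "1 + f1 u \<le> c" using test[of 1 "-1" "-1"] by (simp add: N_def lin) linarith
  moreover have "1 + f2 u \<le> c" using test[of "-1" 1 "-1"] by (simp add: N_def lin) linarith
  moreover have "1 + f3 u \<le> c" using test[of "-1" "-1" 1] by (simp add: N_def lin) linarith
  ultimately show ?thesis using usum by linarith
qed

theorem mainTheorem1:
  shows "((\<nexists>B::'v::real_vector set. finite B \<and> span B = UNIV) \<longrightarrow>
            projection_const TYPE('v) 2 = 4/3 \<and>
            projection_bound TYPE('v) 2 (4/3) \<and>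
            (\<forall>c. projection_bound TYPE('v) 2 c \<longrightarrow> 4/3 \<le> c)) \<and>
         (\<forall>E::'a::real_normed_vector set. subspace E \<and> dim E = 2 \<longrightarrow>
            (\<exists>P. bounded_linear P \<and> range P = E \<and> (\<forall>e\<in>E. P e = e) \<and> onorm P \<le> 4/3))"
proof (intro conjI impI allI)
  assume inf: "\<nexists>B::'v set. finite B \<and> span B = UNIV"
  show "projection_const TYPE('v) 2 = 4/3"
    unfolding projection_const_def
    by (intro Least_equality projection_bound_plane) (rule projection_bound_plane_ge[OF inf])
  show "projection_bound TYPE('v) 2 (4/3)" by (rule projection_bound_plane)
  show "4/3 \<le> c" if "projection_bound TYPE('v) 2 c" for c
    using projection_bound_plane_ge[OF inf that] .
qed (use ex_bounded_linear_projection_on_plane in blast)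

end
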